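(* Let $\mathbf{A}$ be a finite integral representable relation algebra with a flexible atom. Then $\mathbf{A}$ has a normal representation $\mathfrak{B}$.
   Context: Representable relation algebras. For a set $D$ and an equivalence relation $E$ on $D$, consider the algebra on $\mathcal{P}(E)$ with operations $\cup$, $\bar{a}=E\setminus a$, constants $0=\emptyset$, $1=E$, $\mathrm{Id}=\{(x,x)\mid x\in D\}$, converse $a^\smile=\{(x,y)\mid (y,x)\in a\}$, and composition $a\circ b=\{(x,z)\mid \exists y\in D: (x,y)\in a,\ (y,z)\in b\}$. Subalgebras of such algebras are proper relation algebras; a representable relation algebra is an algebra isomorphic to a proper relation algebra. For such $\mathbf{A}$ with domain $A$, $x\le y$ iff $x\cup y=y$; atoms are the minimal elements of $A\setminus\{0\}$, and $A_0$ is the set of atoms. $\mathbf{A}$ is integral if $\mathrm{Id}$ is an atom. With $I=\{a\in A\mid a\le \mathrm{Id}\}$, an atom $s\in A_0\setminus I$ is flexible if $s\le a\circ b$ for all $a,b\in A\setminus I$. A representation of $\mathbf{A}$ is a relational structure $\mathfrak{B}$ with domain $B$ and a binary relation $a^{\mathfrak{B}}$ for each $a\in A$ such that $a\mapsto a^{\mathfrak{B}}$ is an isomorphism from $\mathbf{A}$ onto a proper relation algebra (a subalgebra of the full algebra on $\mathcal{P}(1^{\mathfrak{B}})$). An atomic closed $\mathbf{A}$-network is a finite set $V$ with a total function $g\colon V^2\to A_0$ such that for all $x,y,z\in V$: $g(x,x)\le\mathrm{Id}$, $g(x,y)=g(y,x)^\smile$, and $g(x,z)\le g(x,y)\circ g(y,z)$;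 it is satisfiable in $\mathfrak{B}$ if there is $t\colon V\to B$ with $(t(x),t(y))\in g(x,y)^{\mathfrak{B}}$ for all $x,y\in V$. A representation $\mathfrak{B}$ is normal if it is fully universal (every atomic closed $\mathbf{A}$-network is satisfiable in $\mathfrak{B}$), square ($1^{\mathfrak{B}}=B^2$), and homogeneous (every isomorphism between finite substructures of $\mathfrak{B}$ extends to an automorphism of $\mathfrak{B}$). *)

theory Defs
  imports Main
begin

section \<open>Relation algebras as carrier-based structures\<close>

text \<open>The values of the operations outside the carrier are irrelevant.\<close>

record 'a relalg =
  carrier :: "'a set"
  join :: "'a \<Rightarrow> 'a \<Rightarrow> 'a"
  compl :: "'a \<Rightarrow> 'a"
  zero :: 'a
  one :: 'a
  ident :: 'a
  conv :: "'a \<Rightarrow> 'a"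
  comp :: "'a \<Rightarrow> 'a \<Rightarrow> 'a"

definition is_algebra :: "'a relalg \<Rightarrow> bool" where
  "is_algebra A \<longleftrightarrow>
     zero A \<in> carrier A \<and> one A \<in> carrier A \<and> ident A \<in> carrier A \<and>
     (\<forall>a \<in> carrier A. compl A a \<in> carrier A \<and> conv A a \<in> carrier A) \<and>
     (\<forall>a \<in> carrier A. \<forall>b \<in> carrier A. join A a b \<in> carrier A \<and> comp A a b \<in> carrier A)"

definition subalgebra :: "'a relalg \<Rightarrow> 'a relalg \<Rightarrow> bool" where
  "subalgebra P F \<longleftrightarrow>
     carrier P \<subseteq> carrier F \<and> P = F\<lparr>carrier := carrier P\<rparr> \<and> is_algebra P"

definition relalg_iso :: "'a relalg \<Rightarrow> 'b relalg \<Rightarrow> ('a \<Rightarrow> 'b) \<Rightarrow> bool" where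
  "relalg_iso A P h \<longleftrightarrow>
     is_algebra A \<and> is_algebra P \<and> bij_betw h (carrier A) (carrier P) \<and>
     h (zero A) = zero P \<and> h (one A) = one P \<and> h (ident A) = ident P \<and>
     (\<forall>a \<in> carrier A. h (compl A a) = compl P (h a) \<and> h (conv A a) = conv P (h a)) \<and>
     (\<forall>a \<in> carrier A. \<forall>b \<in> carrier A.
        h (join A a b) = join P (h a) (h b) \<and> h (comp A a b) = comp P (h a) (h b))"

definition full_relalg :: "'b set \<Rightarrow> 'b rel \<Rightarrow> 'b rel relalg" where
  "full_relalg D E =
     \<lparr>carrier = Pow E, join = (\<union>), compl = (\<lambda>a. E - a), zero = {}, one = E,
      ident = Id_on D, conv = converse, comp = (O)\<rparr>"

definition proper_relalg :: "'b rel relalg \<Rightarrow> bool" where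
  "proper_relalg P \<longleftrightarrow> (\<exists>D E. equiv D E \<and> subalgebra P (full_relalg D E))"

text \<open>
  HOL cannot quantify existentially over types, so the type that provides the base set is an
  explicit parameter.
\<close>

definition representable :: "'b itself \<Rightarrow> 'a relalg \<Rightarrow> bool" where
  "representable T A \<longleftrightarrow> (\<exists>(P :: 'b rel relalg) h. proper_relalg P \<and> relalg_iso A P h)"

definition le :: "'a relalg \<Rightarrow> 'a \<Rightarrow> 'a \<Rightarrow> bool" where
  "le A x y \<longleftrightarrow> join A x y = y"

definition atoms :: "'a relalg \<Rightarrow> 'a set" where
  "atoms A = {a \<in> carrier A - {zero A}. \<forall>b \<in> carrier A - {zero A}. le A b a \<longrightarrow> b = a}"

definition integral :: "'a relalg \<Rightarrow> bool" where
  "integral A \<longleftrightarrow> ident A \<in> atoms A"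

definition subidentities :: "'a relalg \<Rightarrow> 'a set" where
  "subidentities A = {a \<in> carrier A. le A a (ident A)}"

definition flexible :: "'a relalg \<Rightarrow> 'a \<Rightarrow> bool" where
  "flexible A s \<longleftrightarrow>
     s \<in> atoms A - subidentities A \<and>
     (\<forall>a \<in> carrier A - subidentities A. \<forall>b \<in> carrier A - subidentities A. le A s (comp A a b))"


section \<open>Relational structures\<close>

text \<open>
  The signature of a structure has one binary relation symbol for each element of a set, namely
  the carrier of the algebra; it is passed separately, and interpretations of other elements
  are irrelevant.
\<close>

record ('a, 'b) relstruct =
  points :: "'b set"
  interp :: "'a \<Rightarrow> 'b rel"

definition substructure :: "('a, 'b) relstruct \<Rightarrow> 'b set \<Rightarrow> ('a, 'b) relstruct" where
  "substructure S X = \<lparr>points = X, interp = (\<lambda>a. interp S a \<inter> X \<times> X)\<rparr>"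

definition struct_iso ::
  "'a set \<Rightarrow> ('a, 'b) relstruct \<Rightarrow> ('a, 'b) relstruct \<Rightarrow> ('b \<Rightarrow> 'b) \<Rightarrow> bool" where
  "struct_iso Sig S T f \<longleftrightarrow>
     bij_betw f (points S) (points T) \<and>
     (\<forall>a \<in> Sig. \<forall>x \<in> points S. \<forall>y \<in> points S. (x, y) \<in> interp S a \<longleftrightarrow> (f x, f y) \<in> interp T a)"

definition homogeneous :: "'a set \<Rightarrow> ('a, 'b) relstruct \<Rightarrow> bool" where
  "homogeneous Sig S \<longleftrightarrow>
     (\<forall>X Y f. finite X \<and> finite Y \<and> X \<subseteq> points S \<and> Y \<subseteq> points S \<and>
        struct_iso Sig (substructure S X) (substructure S Y) f \<longrightarrow>
        (\<exists>g. struct_iso Sig S S g \<and> (\<forall>x \<in> X. g x = f x)))"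


section \<open>Normal representations\<close>

definition representation :: "'a relalg \<Rightarrow> ('a, 'b) relstruct \<Rightarrow> bool" where
  "representation A S \<longleftrightarrow>
     equiv (points S) (interp S (one A)) \<and>
     (\<exists>P. subalgebra P (full_relalg (points S) (interp S (one A))) \<and> relalg_iso A P (interp S))"

definition atomic_closed_network :: "'a relalg \<Rightarrow> 'v set \<Rightarrow> ('v \<Rightarrow> 'v \<Rightarrow> 'a) \<Rightarrow> bool" where
  "atomic_closed_network A V g \<longleftrightarrow>
     finite V \<and>
     (\<forall>x \<in> V. \<forall>y \<in> V. g x y \<in> atoms A) \<and>
     (\<forall>x \<in> V. \<forall>y \<in> V. \<forall>z \<in> V.
        le A (g x x) (ident A) \<and> g x y = conv A (g y x) \<and>
        le A (g x z) (comp A (g x y) (g y z)))"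

definition satisfiable ::
  "('a, 'b) relstruct \<Rightarrow> 'v set \<Rightarrow> ('v \<Rightarrow> 'v \<Rightarrow> 'a) \<Rightarrow> bool" where
  "satisfiable S V g \<longleftrightarrow>
     (\<exists>t. t ` V \<subseteq> points S \<and> (\<forall>x \<in> V. \<forall>y \<in> V. (t x, t y) \<in> interp S (g x y)))"

text \<open>
  Networks are finite, so up to renaming of the variables it suffices to consider finite sets
  of natural numbers.
\<close>

definition fully_universal :: "'a relalg \<Rightarrow> ('a, 'b) relstruct \<Rightarrow> bool" where
  "fully_universal A S \<longleftrightarrow>
     (\<forall>(V :: nat set) g. atomic_closed_network A V g \<longrightarrow> satisfiable S V g)"

definition square :: "'a relalg \<Rightarrow> ('a, 'b) relstruct \<Rightarrow> bool" where
  "square A S \<longleftrightarrow> interp S (one A) = points S \<times> points S"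

definition normal_representation :: "'a relalg \<Rightarrow> ('a, 'b) relstruct \<Rightarrow> bool" where
  "normal_representation A S \<longleftrightarrow>
     representation A S \<and> fully_universal A S \<and> square A S \<and> homogeneous (carrier A) S"

end

theory Submission
  imports Defs "HOL-Library.Countable_Set" "HOL-Library.Nat_Bijection"
begin

text \<open>
  A flexible atom \<open>s\<close> makes the class of finite atomic networks without identified points closed
  under free amalgamation: every undetermined edge may be labelled \<open>s\<close>. Hence a network on the
  natural numbers can be built point by point, such that every consistent one-point type over a
  finite set is realised. This extension property yields universality, the composition law and,
  by back-and-forth, homogeneity. The laws of the atoms are read off from the given
  representation, where \<open>r \<le> p \<circ> q\<close> holds for an atom \<open>r\<close> iff some triangle is labelled by
  \<open>p\<close>, \<open>q\<close>, \<open>r\<close>.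
\<close>

section \<open>Generic edge colourings\<close>

text \<open>Composing an enumeration with the first component of \<open>prod_decode\<close> repeats
  every value: \<open>f i\<close> reappears at index \<open>prod_encode (i, N)\<close>, which is at
  least \<open>N\<close>. A request can thus recur after all points that it mentions exist.\<close>

lemma countable_enum_infinitely_often:
  assumes "countable S" "S \<noteq> {}"
  obtains F :: "nat \<Rightarrow> 'c" where "\<And>t N. t \<in> S \<Longrightarrow> \<exists>n\<ge>N. F n = t"
proof -
  obtain f :: "nat \<Rightarrow> 'c" where f: "S = range f"
    using assms uncountable_def by blast
  have "\<exists>n\<ge>N. f (fst (prod_decode n)) = t" if "t \<in> S" for t N
  proof -
    from that f obtain i where "t = f i" by auto
    then show ?thesis
      by (intro exI[of _ "prod_encode (i, N)"]) (auto simp: le_prod_encode_2)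
  qed
  then show thesis using that[of "\<lambda>n. f (fst (prod_decode n))"] by blast
qed

text \<open>\<open>T p q r\<close> means that a triangle with edges \<open>(x, y)\<close>, \<open>(y, z)\<close>, \<open>(x, z)\<close> coloured
  \<open>p\<close>, \<open>q\<close>, \<open>r\<close> is allowed.\<close>

locale flexible_colours =
  fixes K :: "'a set" and e s :: 'a and cv :: "'a \<Rightarrow> 'a" and T :: "'a \<Rightarrow> 'a \<Rightarrow> 'a \<Rightarrow> bool"
  assumes finite_K: "finite K"
    and e_in: "e \<in> K" and s_in: "s \<in> K" and s_neq: "s \<noteq> e"
    and cv_in: "p \<in> K \<Longrightarrow> cv p \<in> K"
    and cv_cv: "p \<in> K \<Longrightarrow> cv (cv p) = p"
    and cv_e: "cv e = e"
    and rotL: "\<lbrakk>p \<in> K; q \<in> K; r \<in> K; T p q r\<rbrakk> \<Longrightarrow> T (cv p) r q"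
    and rotR: "\<lbrakk>p \<in> K; q \<in> K; r \<in> K; T p q r\<rbrakk> \<Longrightarrow> T r (cv q) p"
    and T_e: "\<lbrakk>p \<in> K; q \<in> K\<rbrakk> \<Longrightarrow> T e p q \<longleftrightarrow> p = q"
    and T_s: "\<lbrakk>p \<in> K; q \<in> K; p \<noteq> e; q \<noteq> e\<rbrakk> \<Longrightarrow> T p q s"
begin

text \<open>An atomic closed network without identified points: the identity colour is confined to
  the diagonal. Triples with repeated points are included.\<close>

definition colouring :: "'v set \<Rightarrow> ('v \<Rightarrow> 'v \<Rightarrow> 'a) \<Rightarrow> bool" where
  "colouring V g \<longleftrightarrow>
     (\<forall>x\<in>V. \<forall>y\<in>V. g x y \<in> K \<and> (g x y = e \<longleftrightarrow> x = y) \<and> g y x = cv (g x y)) \<and>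
     (\<forall>x\<in>V. \<forall>y\<in>V. \<forall>z\<in>V. T (g x y) (g y z) (g x z))"

text \<open>A one-point type over \<open>X\<close>: \<open>p x\<close> is the colour intended for
  the edge from \<open>x\<close> to a new point, so the path from \<open>x\<close> through that
  point to \<open>y\<close> is coloured \<open>p x\<close>, \<open>cv (p y)\<close>. Leaving out
  \<open>e\<close> keeps the new point distinct from those of \<open>X\<close>.\<close>

definition consistent :: "('v \<Rightarrow> 'v \<Rightarrow> 'a) \<Rightarrow> 'v set \<Rightarrow> ('v \<Rightarrow> 'a) \<Rightarrow> bool" where
  "consistent g X p \<longleftrightarrow>
     p ` X \<subseteq> K - {e} \<and> (\<forall>x\<in>X. \<forall>y\<in>X. T (p x) (cv (p y)) (g x y))"

text \<open>The extension property of the Fraisse limit of the finite colourings.\<close>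

definition generic :: "('v \<Rightarrow> 'v \<Rightarrow> 'a) \<Rightarrow> bool" where
  "generic g \<longleftrightarrow> colouring UNIV g \<and>
     (\<forall>X p. finite X \<and> consistent g X p \<longrightarrow> (\<exists>z. \<forall>x\<in>X. g x z = p x))"

definition add_point :: "('v \<Rightarrow> 'v \<Rightarrow> 'a) \<Rightarrow> 'v \<Rightarrow> ('v \<Rightarrow> 'a) \<Rightarrow> 'v \<Rightarrow> 'v \<Rightarrow> 'a" where
  "add_point g v p = (\<lambda>x y. if x = v then (if y = v then e else cv (p y))
                             else if y = v then p x else g x y)"

section \<open>Triangle calculus and free one-point extensions\<close>

lemma cv_eq_e: "p \<in> K \<Longrightarrow> cv p = e \<longleftrightarrow> p = e"
  using cv_cv cv_e by metis

lemma T_cv_e: assumes "p \<in> K" shows "T p (cv p) e"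
proof -
  have "T e p p" using T_e assms by simp
  then show ?thesis using rotR[of e p p] assms e_in by simp
qed

lemma T_right_e: assumes "p \<in> K" shows "T p e p"
  by (metis T_cv_e assms cv_cv cv_in e_in rotL)

lemma colouringD:
  assumes "colouring V g" "x \<in> V" "y \<in> V"
  shows "g x y \<in> K" "g x y = e \<longleftrightarrow> x = y" "g y x = cv (g x y)"
  using assms unfolding colouring_def by blast+

lemma colouring_T:
  assumes "colouring V g" "x \<in> V" "y \<in> V" "z \<in> V"
  shows "T (g x y) (g y z) (g x z)"
  using assms unfolding colouring_def by blast

lemma colouring_consistent:
  assumes "colouring V g" "X \<subseteq> V" "v \<in> V - X"
  shows "consistent g X (\<lambda>x. g x v)"
  unfolding consistent_def
proof (intro conjI ballI)
  have "g x v \<in> K - {e}" if "x \<in> X" for x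
    using colouringD(1,2)[OF assms(1), of x v] assms(2,3) that by auto
  then show "(\<lambda>x. g x v) ` X \<subseteq> K - {e}" by blast
  fix x y assume "x \<in> X" "y \<in> X"
  then have "x \<in> V" "y \<in> V" "v \<in> V" using assms by auto
  then show "T (g x v) (cv (g y v)) (g x y)"
    using colouring_T[OF assms(1), of x v y] colouringD(3)[OF assms(1), of y v] by simp
qed

text \<open>Every triangle through \<open>v\<close> and two old points is a rotation of the
  consistency triangle: \<open>pT\<close>, \<open>pT2\<close> and \<open>pT3\<close> have
  \<open>v\<close> as middle, last and first point.\<close>

lemma colouring_add_point:
  assumes g: "colouring V g" and v: "v \<notin> V" and p: "consistent g V p"
  shows "colouring (insert v V) (add_point g v p)"
proof -
  have pK: "p x \<in> K" "p x \<noteq> e" if "x \<in> V" for x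
    using p that unfolding consistent_def by auto
  have pT: "T (p x) (cv (p y)) (g x y)" if "x \<in> V" "y \<in> V" for x y
    using p that unfolding consistent_def by auto
  have pT2: "T (g x y) (p y) (p x)" if "x \<in> V" "y \<in> V" for x y
    using rotR[OF _ _ _ pT[OF that]] that pK cv_in cv_cv colouringD(1)[OF g] by simp
  have pT3: "T (cv (p x)) (g x y) (cv (p y))" if "x \<in> V" "y \<in> V" for x y
    using rotL[OF _ _ _ pT[OF that]] that pK cv_in colouringD(1)[OF g] by simp
  define h where "h = add_point g v p"
  have h: "h v v = e" "x \<in> V \<Longrightarrow> h x v = p x" "x \<in> V \<Longrightarrow> h v x = cv (p x)"
    "x \<in> V \<Longrightarrow> y \<in> V \<Longrightarrow> h x y = g x y" for x y
    using v by (auto simp: h_def add_point_def)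
  have "h x y \<in> K \<and> (h x y = e \<longleftrightarrow> x = y) \<and> h y x = cv (h x y)"
    if xy: "x \<in> insert v V" "y \<in> insert v V" for x y
  proof -
    consider "x = v" "y = v" | "x = v" "y \<in> V" | "x \<in> V" "y = v" | "x \<in> V" "y \<in> V"
      using xy by blast
    then show ?thesis
    proof cases
      case 4
      then show ?thesis using colouringD[OF g, of x y] by (simp add: h)
    qed (use v in \<open>auto simp: h pK cv_in cv_e e_in cv_cv cv_eq_e\<close>)
  qed
  moreover have "T (h x y) (h y z) (h x z)"
    if xyz: "x \<in> insert v V" "y \<in> insert v V" "z \<in> insert v V" for x y z
  proof -
    \<comment> \<open>The degenerate triangles in which \<open>v\<close> occurs twice.\<close>
    have pe: "T (p x) e (p x)" "T e (cv (p x)) (cv (p x))" "T (cv (p x)) (p x) e"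
      if "x \<in> V" for x
      using T_right_e T_e cv_in T_cv_e[of "cv (p x)"] cv_cv pK[OF that] by simp_all
    have "T e e e" using T_e e_in by simp
    then show ?thesis
      using xyz by (elim insertE) (simp_all add: h pe pT pT2 pT3 colouring_T[OF g])
  qed
  ultimately have "colouring (insert v V) h" unfolding colouring_def by blast
  then show ?thesis by (simp only: h_def)
qed

text \<open>This is where flexibility enters. A pair of distinct points that are not both in
  \<open>X\<close> spans with the new point a triangle with an edge \<open>s\<close> and no edge
  \<open>e\<close>, so \<open>T_s\<close> and the rotations allow it.\<close>

lemma consistent_fill:
  assumes g: "colouring V g" and X: "X \<subseteq> V" and p: "consistent g X p"
  shows "consistent g V (\<lambda>x. if x \<in> X then p x else s)"
proof -
  define q where "q = (\<lambda>x. if x \<in> X then p x else s)"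
  have qK: "q x \<in> K \<and> q x \<noteq> e" for x
    using p s_in s_neq unfolding consistent_def q_def by auto
  have "T (q x) (cv (q y)) (g x y)" if xy: "x \<in> V" "y \<in> V" for x y
  proof -
    note K = qK[of x] qK[of y] cv_in colouringD(1)[OF g xy] colouringD(1)[OF g xy(2,1)]
    consider "x \<in> X" "y \<in> X" | "x = y" | "x \<noteq> y" "y \<notin> X" | "x \<noteq> y" "x \<notin> X" by blast
    then show ?thesis
    proof cases
      case 1
      then show ?thesis using p unfolding consistent_def q_def by simp
    next
      case 2
      then show ?thesis using T_cv_e K colouringD(2)[OF g] xy by metis
    next
      case 3
      \<comment> \<open>\<open>T_s\<close> speaks of the third edge only, so the path is taken from
        \<open>y\<close> through \<open>x\<close> to the new point, with \<open>s\<close> as the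
        colour of its direct edge.\<close>
      have "T (g y x) (q x) s" using T_s K colouringD(2)[OF g xy(2,1)] 3 by metis
      moreover have "q y = s" using 3 by (simp add: q_def)
      ultimately have "T (g x y) (q y) (q x)"
        using rotL[of "g y x" "q x" s] K s_in colouringD(3)[OF g xy(2,1)] by simp
      then show ?thesis using rotR[of "g x y" "q y" "q x"] K by simp
    next
      case 4
      have "T (g x y) (q y) s" using T_s K colouringD(2)[OF g xy] 4 by metis
      moreover have "q x = s" using 4 by (simp add: q_def)
      ultimately show ?thesis using rotR[of "g x y" "q y" "q x"] K by simp
    qed
  qed
  then have "consistent g V q"
    using qK unfolding consistent_def by (simp add: image_subset_iff)
  then show ?thesis by (simp only: q_def)
qed

section \<open>Construction of a generic colouring\<close>

theorem generic_exists: "\<exists>g :: nat \<Rightarrow> nat \<Rightarrow> 'a. generic g"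
proof -
  \<comment> \<open>The possible requests are finite partial functions into \<open>K\<close>, coded
    by association lists so that there are countably many.\<close>
  let ?S = "map_of ` lists ((UNIV :: nat set) \<times> K)"
  have "countable ?S"
    by (intro countable_image countable_lists countable_SIGMA)
      (auto simp: finite_K countable_finite)
  moreover have "?S \<noteq> {}" by auto
  ultimately obtain F :: "nat \<Rightarrow> nat \<Rightarrow> 'a option"
    where F: "\<And>t N. t \<in> ?S \<Longrightarrow> \<exists>n\<ge>N. F n = t"
    using countable_enum_infinitely_often by blast
  \<comment> \<open>A request that mentions points not yet present, or is inconsistent, is replaced
    by the empty one. In either case point \<open>n\<close> is joined by \<open>s\<close> to all
    earlier points that are not mentioned.\<close>
  define X where "X g n = (if dom (F n) \<subseteq> {..<n} \<and> consistent g (dom (F n)) (the \<circ> F n)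
      then dom (F n) else {})" for g n
  define q where "q g n = (\<lambda>x. if x \<in> X g n then (the \<circ> F n) x else s)" for g n
  \<comment> \<open>Only the values of \<open>G n\<close> on points below \<open>n\<close> matter;
    the initial \<open>e\<close> is a dummy.\<close>
  define G where "G = rec_nat (\<lambda>x y. e) (\<lambda>n g. add_point g n (q g n))"
  have G_Suc: "G (Suc n) = add_point (G n) n (q (G n) n)" for n by (simp add: G_def)
  have XX: "X g n \<subseteq> {..<n} \<and> consistent g (X g n) (the \<circ> F n)" for g n
    by (auto simp: X_def consistent_def)
  have G_col: "colouring {..<n} (G n)" for n
  proof (induction n)
    case 0
    then show ?case by (simp add: colouring_def)
  next
    case (Suc n)
    have "consistent (G n) {..<n} (q (G n) n)"
      unfolding q_def using consistent_fill[OF Suc.IH] XX by blast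
    then show ?case
      using colouring_add_point[OF Suc.IH, of n] by (simp add: G_Suc lessThan_Suc)
  qed
  \<comment> \<open>\<open>Suc (max x y)\<close> is the first stage at which both points are
    present; later stages keep the colour.\<close>
  define g where "g x y = G (Suc (max x y)) x y" for x y
  have g_eq: "G n x y = g x y" if "x < n" "y < n" for n x y
    using that
  proof (induction n)
    case (Suc n)
    show ?case
    proof (cases "x < n \<and> y < n")
      case True
      then show ?thesis using Suc by (simp add: G_Suc add_point_def)
    next
      case False
      then have "max x y = n" using Suc.prems by auto
      then show ?thesis by (simp add: g_def)
    qed
  qed simp
  have "colouring UNIV g"
    unfolding colouring_def
  proof (intro conjI ballI)
    fix x y z :: nat
    define n where "n = Suc (max x (max y z))"
    have n: "x < n" "y < n" "z < n" by (auto simp: n_def)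
    show "g x y \<in> K" "g x y = e \<longleftrightarrow> x = y" "g y x = cv (g x y)"
      using colouringD[OF G_col, of x n y] g_eq n by auto
    show "T (g x y) (g y z) (g x z)"
      using colouring_T[OF G_col, of x n y z] g_eq n by auto
  qed
  moreover have "\<exists>z. \<forall>x\<in>Y. g x z = p x" if Y: "finite Y" "consistent g Y p" for Y p
  proof -
    let ?l = "map (\<lambda>x. (x, p x)) (sorted_list_of_set Y)"
    have m: "map_of ?l = (Some \<circ> p) |` Y" using Y by (simp add: map_of_map_restrict)
    have l: "?l \<in> lists (UNIV \<times> K)" 
      using Y(1) conjunct1[OF Y(2)[unfolded consistent_def]] by (auto simp: image_subset_iff)
    have "(Some \<circ> p) |` Y \<in> ?S" using imageI[OF l, of map_of] unfolding m .
    moreover obtain N where N: "\<And>x. x \<in> Y \<Longrightarrow> x < N"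
      using Y(1) finite_nat_set_iff_bounded by auto
    \<comment> \<open>The request is scheduled at a stage beyond all points of \<open>Y\<close>; it
      is then accepted, and the point \<open>n\<close> added at that stage is the witness.\<close>
    ultimately obtain n where n: "n \<ge> N" "F n = (Some \<circ> p) |` Y" using F by blast
    have d: "dom (F n) = Y" "\<And>x. x \<in> Y \<Longrightarrow> the (F n x) = p x" by (auto simp: n(2) restrict_map_def split: if_splits)
    have less: "x < n" if "x \<in> Y" for x using N[OF that] n by simp
    have "consistent (G n) Y (the \<circ> F n)"
      using Y(2) d(2) less g_eq unfolding consistent_def by (auto simp: image_subset_iff)
    then have "X (G n) n = Y" using d(1) less by (auto simp: X_def)
    then have "g x n = p x" if "x \<in> Y" for x
      using g_eq[of x "Suc n" n] that less[OF that] d(2)[OF that]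
      by (simp add: G_Suc add_point_def q_def)
    then show ?thesis by blast
  qed
  ultimately have "generic g" by (simp add: generic_def)
  then show ?thesis by (rule exI[of generic g])
qed

section \<open>Back-and-forth for generic colourings\<close>

lemma generic_colouring: "generic g \<Longrightarrow> colouring UNIV g"
  by (simp add: generic_def)

lemma generic_extend:
  assumes "generic g" "finite X" "consistent g X p"
  obtains z where "\<And>x. x \<in> X \<Longrightarrow> g x z = p x"
proof -
  have "finite X \<and> consistent g X p \<longrightarrow> (\<exists>z. \<forall>x\<in>X. g x z = p x)"
    using conjunct2[OF assms(1)[unfolded generic_def]] by (elim allE)
  then show thesis using assms(2,3) that by blast
qed

text \<open>A relation rather than a function, so that the notion is symmetric under converse. In a
  colouring it is automatically the graph of an injection, because \<open>e\<close> marks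
  equality.\<close>

definition partial_iso :: "('v \<Rightarrow> 'v \<Rightarrow> 'a) \<Rightarrow> ('v \<times> 'v) set \<Rightarrow> bool" where
  "partial_iso g R \<longleftrightarrow> (\<forall>x x' y y'. (x, x') \<in> R \<longrightarrow> (y, y') \<in> R \<longrightarrow> g x y = g x' y')"

lemma partial_iso_converse: "partial_iso g (R\<inverse>) \<longleftrightarrow> partial_iso g R"
  unfolding partial_iso_def converse_iff by metis

text \<open>The type of \<open>a\<close> over the domain is carried along \<open>R\<close> to the
  range. It stays consistent because \<open>R\<close> preserves colours, and genericity supplies a
  point \<open>b\<close> that realises it.\<close>

lemma partial_iso_forth:
  assumes g: "generic g" and R: "finite R" "partial_iso g R"
  shows "\<exists>b. partial_iso g (insert (a, b) R)"
proof (cases "a \<in> Domain R")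
  case True
  then obtain b where "(a, b) \<in> R" by blast
  then show ?thesis using R by (metis insert_absorb)
next
  case False
  note c = generic_colouring[OF g]
  note E = colouringD(2)[OF c UNIV_I UNIV_I]
  note C = colouringD(3)[OF c UNIV_I UNIV_I]
  have RD: "g x y = g x' y'" if "(x, x') \<in> R" "(y, y') \<in> R" for x x' y y'
    using R(2) that unfolding partial_iso_def by blast
  \<comment> \<open>A choice of preimages; \<open>i_eq\<close> shows it to be unique, as points
    joined by \<open>e\<close> are equal.\<close>
  define i where "i x' = (SOME x. (x, x') \<in> R)" for x'
  have i: "(i x', x') \<in> R" if "x' \<in> Range R" for x'
    using that unfolding i_def by (auto intro: someI)
  have i_eq: "i x' = x" if "(x, x') \<in> R" for x x'
    using RD[OF i[OF RangeI[OF that]] that] E[of x' x'] E[of "i x'" x] by simp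
  have "i ` Range R \<subseteq> UNIV" "a \<in> UNIV - i ` Range R" using False i by auto
  then have "consistent g (i ` Range R) (\<lambda>x. g x a)" by (rule colouring_consistent[OF c])
  then have cons: "consistent g (Range R) (\<lambda>x'. g (i x') a)"
    using RD[OF i i] unfolding consistent_def by (simp add: image_subset_iff)
  obtain b where b: "\<And>x'. x' \<in> Range R \<Longrightarrow> g x' b = g (i x') a"
    using generic_extend[OF g finite_Range[OF R(1)] cons] by blast
  have 1: "g x a = g x' b" if "(x, x') \<in> R" for x x'
    using b[OF RangeI[OF that]] i_eq[OF that] by simp
  have 2: "g a x = g b x'" if "(x, x') \<in> R" for x x'
    using 1[OF that] C[of a x] C[of b x'] by simp
  have 3: "g a a = g b b" using E[of a a] E[of b b] by simp
  have "partial_iso g (insert (a, b) R)"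
    unfolding partial_iso_def
  proof (intro allI impI)
    fix x x' y y' assume "(x, x') \<in> insert (a, b) R" "(y, y') \<in> insert (a, b) R"
    then consider "x = a" "x' = b" "y = a" "y' = b" | "x = a" "x' = b" "(y, y') \<in> R"
      | "(x, x') \<in> R" "y = a" "y' = b" | "(x, x') \<in> R" "(y, y') \<in> R"
      by blast
    then show "g x y = g x' y'" by cases (use 1 2 3 RD in blast)+
  qed
  then show ?thesis by blast
qed

lemma partial_iso_back:
  assumes "generic g" "finite R" "partial_iso g R"
  shows "\<exists>a. partial_iso g (insert (a, b) R)"
proof -
  have "finite (R\<inverse>)" "partial_iso g (R\<inverse>)"
    using assms(2,3) by (simp_all add: partial_iso_converse)
  then obtain a where a: "partial_iso g (insert (b, a) (R\<inverse>))"
    using partial_iso_forth[OF assms(1)] by blast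
  have eq: "insert (b, a) (R\<inverse>) = (insert (a, b) R)\<inverse>" by auto
  have "partial_iso g (insert (a, b) R)"
    using a unfolding eq partial_iso_converse .
  then show ?thesis by blast
qed

lemma partial_iso_extends_automorphism:
  fixes g :: "nat \<Rightarrow> nat \<Rightarrow> 'a"
  assumes g: "generic g" and R: "finite R" "partial_iso g R"
  shows "\<exists>f. bij f \<and> (\<forall>x y. g (f x) (f y) = g x y) \<and> (\<forall>(x, y) \<in> R. f x = y)"
proof -
  note c = generic_colouring[OF g]
  \<comment> \<open>A chain of finite partial isomorphisms extending \<open>R\<close>: step
    \<open>n\<close> puts \<open>n\<close> into both domain and range, so the union is total and
    surjective.\<close>
  let ?P = "\<lambda>n Q. finite Q \<and> partial_iso g Q \<and> R \<subseteq> Q"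
  let ?Q = "\<lambda>n Q Q'. Q \<subseteq> Q' \<and> n \<in> Domain Q' \<and> n \<in> Range Q'"
  have step: "\<exists>Q'. ?P (Suc n) Q' \<and> ?Q n Q Q'" if "?P n Q" for n Q
  proof -
    obtain b where b: "partial_iso g (insert (n, b) Q)" using partial_iso_forth[OF g] \<open>?P n Q\<close> by blast
    then obtain a where "partial_iso g (insert (a, n) (insert (n, b) Q))"
      using partial_iso_back[OF g _ b] \<open>?P n Q\<close> by blast
    then show ?thesis using \<open>?P n Q\<close> by (intro exI[of _ "insert (a, n) (insert (n, b) Q)"]) auto
  qed
  have "\<exists>Q. \<forall>n. ?P n (Q n) \<and> ?Q n (Q n) (Q (Suc n))"
    by (rule dependent_nat_choice[of ?P ?Q, OF _ step]) (use R in auto)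
  then obtain Q where "\<forall>n. ?P n (Q n) \<and> ?Q n (Q n) (Q (Suc n))" ..
  then have Q: "?P n (Q n)" "?Q n (Q n) (Q (Suc n))" for n by auto
  define U where "U = (\<Union>n. Q n)"
  have mono: "Q m \<subseteq> Q n" if "m \<le> n" for m n
    using lift_Suc_mono_le[of Q, OF _ that] Q(2) by blast
  have UD: "g x y = g x' y'" if xy: "(x, x') \<in> U" "(y, y') \<in> U" for x x' y y'
  proof -
    obtain m n where "(x, x') \<in> Q m" "(y, y') \<in> Q n" using xy unfolding U_def by blast
    then have "(x, x') \<in> Q (max m n)" "(y, y') \<in> Q (max m n)"
      using mono[of m "max m n"] mono[of n "max m n"] by auto
    then show ?thesis using Q(1)[of "max m n"] unfolding partial_iso_def by blast
  qed
  \<comment> \<open>Equality of points is the colour \<open>e\<close>, so preservation of colours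
    makes \<open>U\<close> functional and injective.\<close>
  have U_inj: "x = y \<longleftrightarrow> x' = y'" if "(x, x') \<in> U" "(y, y') \<in> U" for x x' y y'
    using UD[OF that] colouringD(2)[OF c] by (metis UNIV_I)
  have tot: "\<exists>y. (x, y) \<in> U" "\<exists>y. (y, x) \<in> U" for x
    using Q(2)[of x] unfolding U_def by blast+
  obtain f where f: "\<And>x. (x, f x) \<in> U" using tot(1) by metis
  have "bij f"
    unfolding bij_def inj_def surj_def using f U_inj tot(2) by metis
  moreover have "f x = y" if "(x, y) \<in> R" for x y
  proof -
    have "(x, y) \<in> U" using that Q(1) U_def by blast
    then show ?thesis using U_inj[OF f[of x]] by blast
  qed
  ultimately show ?thesis using UD[OF f f] by (intro exI[of _ f]) auto
qed

section \<open>Realisation of edges, triangles and networks\<close>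

lemma generic_edge:
  assumes g: "generic g" and p: "p \<in> K"
  shows "\<exists>y. g x y = p"
proof (cases "p = e")
  case True
  then show ?thesis using colouringD(2)[OF generic_colouring[OF g], of x x] by auto
next
  case False
  have "g x x = e" using colouringD(2)[OF generic_colouring[OF g]] by blast
  then have "consistent g {x} (\<lambda>_. p)" using False p T_cv_e by (simp add: consistent_def)
  then show ?thesis using generic_extend[OF g, of "{x}" "\<lambda>_. p"] by auto
qed

text \<open>The existence half of the composition law. The type over \<open>{x, z}\<close> requires
  distinct points and colours other than \<open>e\<close>; the degenerate cases are settled by
  \<open>x\<close>, by \<open>z\<close> or by \<open>generic_edge\<close>.\<close>

lemma generic_triangle:
  assumes g: "generic g" and pq: "p \<in> K" "q \<in> K" and T: "T p q (g x z)"
  shows "\<exists>y. g x y = p \<and> g y z = q"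
proof -
  note c = generic_colouring[OF g]
  note K = colouringD(1)[OF c UNIV_I UNIV_I]
  note E = colouringD(2)[OF c UNIV_I UNIV_I]
  note C = colouringD(3)[OF c UNIV_I UNIV_I]
  have T': "T (cv p) (g x z) q" using rotL T pq K by blast
  show ?thesis
  proof (cases "p = e \<or> q = e \<or> x = z")
    case True
    then consider "p = e" | "q = e" | "x = z" by blast
    then show ?thesis
    proof cases
      case 1
      then have "q = g x z" using T T_e pq K by blast
      then show ?thesis using 1 E by blast
    next
      case 2
      \<comment> \<open>\<open>T_e\<close> governs \<open>e\<close> as first edge only; the
        rotations move it there.\<close>
      then have "T (g x z) (cv e) p" using rotR T pq K by blast
      then have "T (cv (g x z)) p e" using rotL K pq e_in cv_e by metis
      then have "T e (cv p) (cv (g x z))" using rotR K pq e_in cv_in by blast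
      then have "cv p = cv (g x z)" using T_e K pq cv_in by blast
      then have "p = g x z" using cv_cv pq K by metis
      then show ?thesis using 2 E by blast
    next
      case 3
      then have "T (cv p) e q" using T' E by metis
      then have "T p q e" using rotL[of "cv p" e q] cv_cv cv_in e_in pq by metis
      then have "T e (cv q) p" using rotR e_in pq by blast
      then have "cv q = p" using T_e e_in pq cv_in by blast
      moreover obtain y where "g x y = p" using generic_edge[OF g pq(1)] by blast
      ultimately show ?thesis using 3 C cv_cv pq by metis
    qed
  next
    case False
    \<comment> \<open>The type is directed towards the new point \<open>y\<close>, whence
      \<open>cv q\<close> for the edge from \<open>z\<close>.\<close>
    let ?r = "\<lambda>y. if y = x then p else cv q"
    have q': "cv q \<in> K" "cv q \<noteq> e" using cv_in pq cv_eq_e False by auto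
    have "T p (cv p) (g x x)" "T (cv q) (cv (cv q)) (g z z)"
      using T_cv_e pq q' E by metis+
    moreover have "T p (cv (cv q)) (g x z)" using T cv_cv pq by simp
    moreover have "T (cv q) (cv p) (g z x)"
    proof -
      have "T q (cv (g x z)) (cv p)" using rotR[OF _ _ _ T'] cv_in pq K by simp
      then show ?thesis using rotL C[of z x] cv_in pq K by metis
    qed
    ultimately have "consistent g {x, z} ?r"
      using False pq q' unfolding consistent_def by auto
    then obtain y where y: "\<And>w. w \<in> {x, z} \<Longrightarrow> g w y = ?r w"
      using generic_extend[OF g, of "{x, z}" ?r] by blast
    have "g x y = p" "g z y = cv q" using y[of x] y[of z] False by (auto split: if_splits)
    then show ?thesis using C[of y z] cv_cv[OF pq(2)] by auto
  qed
qed

text \<open>Unlike a colouring, the network may give the colour \<open>e\<close> to a pair of distinct points.\<close>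

lemma generic_universal:
  assumes g: "generic g" and "finite V"
    and K: "\<And>x y. x \<in> V \<Longrightarrow> y \<in> V \<Longrightarrow> n x y \<in> K"
    and refl: "\<And>x. x \<in> V \<Longrightarrow> n x x = e"
    and cv: "\<And>x y. x \<in> V \<Longrightarrow> y \<in> V \<Longrightarrow> n x y = cv (n y x)"
    and T: "\<And>x y z. x \<in> V \<Longrightarrow> y \<in> V \<Longrightarrow> z \<in> V \<Longrightarrow> T (n x y) (n y z) (n x z)"
  shows "\<exists>t. \<forall>x\<in>V. \<forall>y\<in>V. g (t x) (t y) = n x y"
  using assms(2-)
proof (induction V)
  case empty
  show ?case by simp
next
  case (insert v V)
  note c = generic_colouring[OF g]
  note E = colouringD(2)[OF c UNIV_I UNIV_I]
  note C = colouringD(3)[OF c UNIV_I UNIV_I]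
  have "\<exists>t. \<forall>x\<in>V. \<forall>y\<in>V. g (t x) (t y) = n x y"
    by (rule insert.IH; rule insert.prems; simp)
  then obtain t where t: "\<And>x y. x \<in> V \<Longrightarrow> y \<in> V \<Longrightarrow> g (t x) (t y) = n x y" by blast
  \<comment> \<open>Points joined by \<open>e\<close> have the same edges to all others, so they may
    share an image.\<close>
  have e_eq: "n x z = n y z" if "n x y = e" "x \<in> insert v V" "y \<in> insert v V" "z \<in> insert v V" for x y z
    using T_e[of "n y z" "n x z"] insert.prems that by metis
  have "\<exists>b. \<forall>x\<in>V. g (t x) b = n x v"
  \<comment> \<open>If the network identifies \<open>v\<close> with a point already placed, the
    image of that point serves again.\<close>
  proof (cases "\<exists>w\<in>V. n v w = e")
    case True
    then obtain w where w: "w \<in> V" "n v w = e" by blast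
    have "n x w = n x v" if "x \<in> V" for x
      using e_eq[OF w(2), of x] insert.prems(3)[of x w] insert.prems(3)[of x v] w that by simp
    then show ?thesis using t w(1) by (intro exI[of _ "t w"]) simp
  next
    case False
    \<comment> \<open>\<open>t\<close> may identify points of \<open>V\<close>, so the type over the
      image is read off representatives; \<open>i_eq\<close> makes the choice immaterial.\<close>
    define i where "i x' = (SOME x. x \<in> V \<and> t x = x')" for x'
    have i: "i (t x) \<in> V \<and> t (i (t x)) = t x" if "x \<in> V" for x
      unfolding i_def by (rule someI[of _ x]) (use that in simp)
    have i_eq: "n (i (t x)) v = n x v" if "x \<in> V" for x
      using e_eq[of "i (t x)" x v] t[of "i (t x)" x] i[OF that] that E[of "t x" "t x"] by simp
    have "consistent g (t ` V) (\<lambda>x'. n (i x') v)"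
      unfolding consistent_def
    proof (intro conjI ballI)
      have "n x v \<in> K - {e}" if "x \<in> V" for x
        using that insert.prems(1)[of x v] insert.prems(3)[of v x] cv_e False by auto
      then show "(\<lambda>x'. n (i x') v) ` t ` V \<subseteq> K - {e}" using i by auto
      fix x' y' assume "x' \<in> t ` V" "y' \<in> t ` V"
      then obtain x y where xy: "x \<in> V" "y \<in> V" "x' = t x" "y' = t y" by blast
      then show "T (n (i x') v) (cv (n (i y') v)) (g x' y')"
        using i_eq t insert.prems(4)[of x v y] insert.prems(3)[of v y] by simp
    qed
    then obtain b where "\<And>x'. x' \<in> t ` V \<Longrightarrow> g x' b = n (i x') v"
      using generic_extend[OF g] insert.hyps(1) by blast
    then show ?thesis using i_eq by (intro exI[of _ b]) simp
  qed
  then obtain b where b: "\<And>x. x \<in> V \<Longrightarrow> g (t x) b = n x v" by blast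
  have b': "g b (t x) = n v x" if "x \<in> V" for x
    using b[OF that] C[of b "t x"] insert.prems(3)[of v x] that by simp
  have "g b b = n v v" using E insert.prems(2) by simp
  then show ?case
    using t b b' insert.hyps(2) by (intro exI[of _ "t(v := b)"]) auto
qed

end

section \<open>Atoms of a finite integral represented algebra\<close>

text \<open>The given representation in unfolded form: the embedding \<open>h\<close> into the
  subsets of \<open>E\<close> turns laws of the algebra into facts about relations.\<close>

locale finite_represented_relalg =
  fixes A :: "'a relalg" and D :: "'b set" and E :: "'b rel" and h :: "'a \<Rightarrow> 'b rel"
  assumes equiv: "equiv D E"
    and fin: "finite (carrier A)"
    and alg: "is_algebra A"
    and h_inj: "inj_on h (carrier A)"
    and h_sub: "a \<in> carrier A \<Longrightarrow> h a \<subseteq> E"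
    and h_zero: "h (zero A) = {}"
    and h_one: "h (one A) = E"
    and h_ident: "h (ident A) = Id_on D"
    and h_compl: "a \<in> carrier A \<Longrightarrow> h (compl A a) = E - h a"
    and h_conv: "a \<in> carrier A \<Longrightarrow> h (conv A a) = (h a)\<inverse>"
    and h_join: "a \<in> carrier A \<Longrightarrow> b \<in> carrier A \<Longrightarrow> h (join A a b) = h a \<union> h b"
    and h_comp: "a \<in> carrier A \<Longrightarrow> b \<in> carrier A \<Longrightarrow> h (comp A a b) = h a O h b"
begin

section \<open>Atoms, inclusion and triangles in the given representation\<close>

lemma closed:
  "zero A \<in> carrier A" "one A \<in> carrier A" "ident A \<in> carrier A"
  "a \<in> carrier A \<Longrightarrow> compl A a \<in> carrier A"
  "a \<in> carrier A \<Longrightarrow> conv A a \<in> carrier A"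
  "a \<in> carrier A \<Longrightarrow> b \<in> carrier A \<Longrightarrow> join A a b \<in> carrier A"
  "a \<in> carrier A \<Longrightarrow> b \<in> carrier A \<Longrightarrow> comp A a b \<in> carrier A"
  using alg unfolding is_algebra_def by auto

lemma h_eq: "a \<in> carrier A \<Longrightarrow> b \<in> carrier A \<Longrightarrow> h a = h b \<longleftrightarrow> a = b"
  using h_inj inj_on_eq_iff by metis

lemma le_iff: "a \<in> carrier A \<Longrightarrow> b \<in> carrier A \<Longrightarrow> le A a b \<longleftrightarrow> h a \<subseteq> h b"
  unfolding le_def using h_eq[of "join A a b" b] h_join closed by (metis subset_Un_eq)

lemma atom_carrier: "p \<in> atoms A \<Longrightarrow> p \<in> carrier A"
  by (simp add: atoms_def)

lemma atom_nonempty: "p \<in> atoms A \<Longrightarrow> h p \<noteq> {}"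
  using h_eq[of p "zero A"] closed h_zero by (auto simp: atoms_def)

lemma h_diff:
  assumes "a \<in> carrier A" "b \<in> carrier A"
  shows "\<exists>c\<in>carrier A. h c = h a - h b"
proof
  show "compl A (join A (compl A a) b) \<in> carrier A" using closed assms by simp
  show "h (compl A (join A (compl A a) b)) = h a - h b"
    using closed assms h_sub[OF assms(1)] by (auto simp: h_compl h_join)
qed

text \<open>The relation \<open>h p - h a\<close> belongs to an element below \<open>p\<close>,
  hence to zero or to \<open>p\<close>; the common pair excludes the latter.\<close>

lemma atom_sub:
  assumes p: "p \<in> atoms A" and a: "a \<in> carrier A" and uv: "(u, v) \<in> h p" "(u, v) \<in> h a"
  shows "h p \<subseteq> h a"
proof -
  note pc = atom_carrier[OF p]
  obtain c where c: "c \<in> carrier A" "h c = h p - h a" using h_diff pc a by blast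
  have "c = zero A \<or> c = p"
    using p c le_iff[OF c(1) pc] unfolding atoms_def by blast
  then show ?thesis using c uv h_zero by blast
qed

lemma atom_unique:
  assumes "p \<in> atoms A" "q \<in> atoms A" "uv \<in> h p" "uv \<in> h q"
  shows "p = q"
proof (cases uv)
  case (Pair u v)
  then have "h p = h q" using atom_sub[of p q u v] atom_sub[of q p u v] assms atom_carrier by blast
  then show ?thesis using h_eq assms atom_carrier by blast
qed

text \<open>Finiteness yields a minimal relation through \<open>uv\<close> inside
  \<open>h a\<close>. It belongs to an atom, since for any element below it either that element or
  its relative complement contains \<open>uv\<close>.\<close>

lemma atom_exists:
  assumes a: "a \<in> carrier A" and uv: "uv \<in> h a"
  shows "\<exists>p\<in>atoms A. uv \<in> h p \<and> h p \<subseteq> h a"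
proof -
  define S where "S = h ` {b \<in> carrier A. uv \<in> h b}"
  have S: "finite S" "h a \<in> S" using fin a uv by (simp_all add: S_def)
  obtain m where "m \<in> S" and m: "m \<subseteq> h a" "\<forall>b\<in>S. b \<subseteq> m \<longrightarrow> m = b"
    using finite_has_minimal2[OF S] by (elim bexE conjE)
  obtain p where p: "p \<in> carrier A" "uv \<in> h p" "m = h p" using \<open>m \<in> S\<close> S_def by blast
  have "b = p" if b: "b \<in> carrier A - {zero A}" "le A b p" for b
  proof -
    have sub: "h b \<subseteq> h p" using b p le_iff by blast
    show ?thesis
    proof (cases "uv \<in> h b")
      case True
      then show ?thesis using bspec[OF m(2), of "h b"] sub b p h_eq by (auto simp: S_def)
    next
      case False
      obtain c where c: "c \<in> carrier A" "h c = h p - h b" using h_diff p b by blast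
      then have "h p = h c" using bspec[OF m(2), of "h c"] p False by (auto simp: S_def)
      then have "h b = {}" using sub c by blast
      then show ?thesis using b closed h_zero h_eq[of b "zero A"] by auto
    qed
  qed
  moreover have "p \<noteq> zero A" using p h_zero by auto
  ultimately have "p \<in> atoms A" using p unfolding atoms_def by blast
  then show ?thesis using p m(1) by blast
qed

text \<open>The arguments may be arbitrary elements, so the same notion serves as the predicate
  \<open>T\<close> on atoms and describes compositions of non-atoms.\<close>

definition triangle :: "'a \<Rightarrow> 'a \<Rightarrow> 'a \<Rightarrow> bool" where
  "triangle p q r \<longleftrightarrow> (\<exists>x y z. (x, y) \<in> h p \<and> (y, z) \<in> h q \<and> (x, z) \<in> h r)"

text \<open>One pair of \<open>h r\<close> in the composition suffices, since an atom that meets an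
  element lies below it.\<close>

lemma le_comp_iff:
  assumes "r \<in> atoms A" "a \<in> carrier A" "b \<in> carrier A"
  shows "le A r (comp A a b) \<longleftrightarrow> triangle a b r"
proof
  have le: "le A r (comp A a b) \<longleftrightarrow> h r \<subseteq> h a O h b"
    using le_iff closed h_comp assms atom_carrier by simp
  {
    assume "le A r (comp A a b)"
    moreover obtain x z where "(x, z) \<in> h r" using atom_nonempty[OF assms(1)] by auto
    ultimately show "triangle a b r" using le unfolding triangle_def by blast
  next
    assume "triangle a b r"
    then obtain x z where "(x, z) \<in> h r" "(x, z) \<in> h a O h b" unfolding triangle_def by blast
    then show "le A r (comp A a b)"
      using le atom_sub[of r "comp A a b"] assms closed h_comp by metis
  }
qed

lemma conv_conv: "a \<in> carrier A \<Longrightarrow> conv A (conv A a) = a"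
  using h_eq[of "conv A (conv A a)" a] h_conv closed by simp

text \<open>An atom \<open>q\<close> below \<open>conv A p\<close> has a converse that meets the
  atom \<open>p\<close> and so contains it; hence \<open>q\<close> equals
  \<open>conv A p\<close>.\<close>

lemma conv_atom:
  assumes "p \<in> atoms A" shows "conv A p \<in> atoms A"
proof -
  note pc = atom_carrier[OF assms]
  obtain u v where uv: "(v, u) \<in> h p" using atom_nonempty[OF assms] by auto
  then have "(u, v) \<in> h (conv A p)" using h_conv pc by simp
  then obtain q where q: "q \<in> atoms A" "(u, v) \<in> h q" "h q \<subseteq> h (conv A p)"
    using atom_exists[OF closed(5)[OF pc]] by blast
  have "h p \<subseteq> h (conv A q)"
    using atom_sub[OF assms, of "conv A q" v u] uv q closed h_conv atom_carrier by simp
  then have "h q = h (conv A p)" using q h_conv pc atom_carrier by auto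
  then show ?thesis using q h_eq pc closed atom_carrier by metis
qed

end

section \<open>Atoms as flexible colours\<close>

locale flexible_integral_relalg = finite_represented_relalg +
  fixes s
  assumes int: "integral A" and flex: "flexible A s"
begin

lemma ident_atom: "ident A \<in> atoms A"
  using int by (simp add: integral_def)

lemma atom_le_ident: "p \<in> atoms A \<Longrightarrow> le A p (ident A) \<longleftrightarrow> p = ident A"
  using ident_atom le_iff[of "ident A" "ident A"] closed(3) unfolding atoms_def by auto

lemma atom_not_subidentity: "p \<in> atoms A \<Longrightarrow> p \<noteq> ident A \<Longrightarrow> p \<in> carrier A - subidentities A"
  using atom_le_ident atom_carrier by (auto simp: subidentities_def)

text \<open>Integrality makes \<open>ident A\<close> the only atom below the identity, so it can
  serve as \<open>e\<close>. Flexibility, restated through \<open>le_comp_iff\<close>, gives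
  \<open>T_s\<close>.\<close>

sublocale flexible_colours "atoms A" "ident A" s "conv A" triangle
proof
  show "finite (atoms A)" using fin by (auto simp: atoms_def intro: finite_subset)
  show "ident A \<in> atoms A" by (rule ident_atom)
  show s: "s \<in> atoms A" using flex by (simp add: flexible_def)
  show "s \<noteq> ident A" using flex atom_le_ident s atom_carrier by (auto simp: flexible_def subidentities_def)
  have "h (conv A (ident A)) = h (ident A)" using h_conv h_ident closed by (simp add: converse_Id_on)
  then show "conv A (ident A) = ident A" using h_eq closed by simp
  fix p q assume p: "p \<in> atoms A" and q: "q \<in> atoms A"
  show "conv A p \<in> atoms A" "conv A (conv A p) = p"
    using p conv_atom conv_conv atom_carrier by auto
  have pD: "(u, v) \<in> h p \<Longrightarrow> u \<in> D" for u v
    using p atom_carrier h_sub equiv_type[OF equiv] by blast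
  show "triangle (ident A) p q \<longleftrightarrow> p = q"
  proof
    assume "triangle (ident A) p q"
    then show "p = q" using atom_unique p q unfolding triangle_def h_ident by blast
  next
    assume "p = q"
    moreover obtain u v where "(u, v) \<in> h p" using atom_nonempty[OF p] by auto
    ultimately show "triangle (ident A) p q" using pD unfolding triangle_def h_ident by blast
  qed
  show "triangle p q s" if "p \<noteq> ident A" "q \<noteq> ident A"
    using flex atom_not_subidentity that p q le_comp_iff[OF s] by (auto simp: flexible_def)
  fix r assume r: "r \<in> atoms A" and T: "triangle p q r"
  \<comment> \<open>The same three points, read from another vertex, witness the rotated
    triangle.\<close>
  show "triangle (conv A p) r q" "triangle r (conv A q) p"
    using T p q r atom_carrier h_conv unfolding triangle_def by (metis converse_iff)+
qed

text \<open>Every edge carries one atom, and \<open>a\<close> is interpreted as the union of the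
  colour classes of the atoms below it.\<close>

definition network_structure :: "(nat \<Rightarrow> nat \<Rightarrow> 'a) \<Rightarrow> ('a, nat) relstruct" where
  "network_structure g = \<lparr>points = UNIV, interp = (\<lambda>a. {(x, y). le A (g x y) a})\<rparr>"

lemma atom_le_atom:
  assumes "p \<in> atoms A" "q \<in> atoms A"
  shows "le A p q \<longleftrightarrow> p = q"
proof -
  have "le A p q \<Longrightarrow> p = q" using assms by (auto simp: atoms_def)
  moreover have "le A p p" using assms atom_carrier le_iff by blast
  ultimately show ?thesis by blast
qed

lemma atom_le:
  assumes "p \<in> atoms A" "uv \<in> h p" "a \<in> carrier A"
  shows "le A p a \<longleftrightarrow> uv \<in> h a"
  using assms le_iff[of p a] atom_carrier atom_sub[of p a "fst uv" "snd uv"] by auto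

section \<open>The normal representation given by a generic colouring\<close>

context
  fixes g :: "nat \<Rightarrow> nat \<Rightarrow> 'a"
  assumes g: "generic g"
begin

lemmas g_atom = colouringD(1)[OF generic_colouring[OF g] UNIV_I UNIV_I]
lemmas g_ident = colouringD(2)[OF generic_colouring[OF g] UNIV_I UNIV_I]
lemmas g_conv = colouringD(3)[OF generic_colouring[OF g] UNIV_I UNIV_I]

abbreviation "R \<equiv> interp (network_structure g)"

lemma R_iff: "(x, y) \<in> R a \<longleftrightarrow> le A (g x y) a"
  by (simp add: network_structure_def)

lemma R_atom: "p \<in> atoms A \<Longrightarrow> (x, y) \<in> R p \<longleftrightarrow> g x y = p"
  using R_iff atom_le_atom g_atom by auto

text \<open>Any pair in \<open>h (g x y)\<close> will do, because an atom lies below an element as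
  soon as it meets it. The sample is uniform in \<open>a\<close>, so the Boolean laws of
  \<open>h\<close> transfer to \<open>R\<close> edge by edge.\<close>

lemma R_sample: "\<exists>uv\<in>E. \<forall>a\<in>carrier A. (x, y) \<in> R a \<longleftrightarrow> uv \<in> h a"
proof -
  obtain uv where uv: "uv \<in> h (g x y)" using atom_nonempty[OF g_atom[of x y]] by blast
  show ?thesis
  proof (intro bexI[of _ uv] ballI)
    show "uv \<in> E" using uv h_sub[OF atom_carrier[OF g_atom[of x y]]] by blast
    show "(x, y) \<in> R a \<longleftrightarrow> uv \<in> h a" if "a \<in> carrier A" for a
      unfolding R_iff by (rule atom_le[OF g_atom uv that])
  qed
qed

lemma R_zero: "R (zero A) = {}"
proof -
  have "(x, y) \<notin> R (zero A)" for x y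
    using R_sample[of x y] closed(1) h_zero by fastforce
  then show ?thesis by auto
qed

lemma R_one: "R (one A) = UNIV"
proof -
  have "(x, y) \<in> R (one A)" for x y
    using R_sample[of x y] closed(2) h_one by fastforce
  then show ?thesis by (simp add: set_eq_iff)
qed

lemma R_ident: "R (ident A) = Id"
  using R_atom[OF ident_atom] g_ident by auto

lemma R_compl: assumes a: "a \<in> carrier A" shows "R (compl A a) = UNIV - R a"
proof -
  have "(x, y) \<in> R (compl A a) \<longleftrightarrow> (x, y) \<notin> R a" for x y
    using R_sample[of x y] a closed(4)[OF a] h_compl[OF a] by fastforce
  then show ?thesis by (simp add: set_eq_iff)
qed

lemma R_join:
  assumes ab: "a \<in> carrier A" "b \<in> carrier A"
  shows "R (join A a b) = R a \<union> R b"
proof -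
  have "(x, y) \<in> R (join A a b) \<longleftrightarrow> (x, y) \<in> R a \<or> (x, y) \<in> R b" for x y
    using R_sample[of x y] ab closed(6)[OF ab] h_join[OF ab] by fastforce
  then show ?thesis by (simp add: set_eq_iff)
qed

lemma R_conv: assumes "a \<in> carrier A" shows "R (conv A a) = (R a)\<inverse>"
proof -
  have "(x, y) \<in> R (conv A a) \<longleftrightarrow> (y, x) \<in> R a" for x y
  proof -
    have "g x y \<in> carrier A" "g y x \<in> carrier A" using g_atom atom_carrier by auto
    moreover have "h (g y x) = (h (g x y))\<inverse>" using g_conv[of y x] h_conv calculation by simp
    ultimately show ?thesis using assms closed le_iff h_conv by (auto simp: R_iff)
  qed
  then show ?thesis by auto
qed

text \<open>From left to right, a witnessing triangle is refined to atoms and realised by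
  \<open>generic_triangle\<close>; the other direction reads a triangle off the colouring.\<close>

lemma R_comp:
  assumes "a \<in> carrier A" "b \<in> carrier A"
  shows "R (comp A a b) = R a O R b"
proof -
  have "(x, z) \<in> R (comp A a b) \<longleftrightarrow> (\<exists>y. (x, y) \<in> R a \<and> (y, z) \<in> R b)" for x z
  proof
    assume "(x, z) \<in> R (comp A a b)"
    then have "triangle a b (g x z)" using R_iff le_comp_iff g_atom assms by blast
    then obtain u v w where uvw: "(u, v) \<in> h a" "(v, w) \<in> h b" "(u, w) \<in> h (g x z)"
      unfolding triangle_def by blast
    obtain p where p: "p \<in> atoms A" "(u, v) \<in> h p" "h p \<subseteq> h a" using atom_exists uvw assms by blast
    obtain q where q: "q \<in> atoms A" "(v, w) \<in> h q" "h q \<subseteq> h b" using atom_exists uvw assms by blast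
    have "triangle p q (g x z)" using p q uvw unfolding triangle_def by blast
    then obtain y where "g x y = p" "g y z = q" using generic_triangle[OF g] p q by blast
    then show "\<exists>y. (x, y) \<in> R a \<and> (y, z) \<in> R b"
      using p q R_iff le_iff assms atom_carrier by blast
  next
    assume "\<exists>y. (x, y) \<in> R a \<and> (y, z) \<in> R b"
    then obtain y where y: "(x, y) \<in> R a" "(y, z) \<in> R b" by blast
    have "triangle (g x y) (g y z) (g x z)" using colouring_T[OF generic_colouring[OF g]] by blast
    moreover have "h (g x y) \<subseteq> h a" "h (g y z) \<subseteq> h b"
      using y R_iff le_iff assms g_atom atom_carrier by blast+
    ultimately have "triangle a b (g x z)" unfolding triangle_def by blast
    then show "(x, z) \<in> R (comp A a b)" using R_iff le_comp_iff g_atom assms by blast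
  qed
  then show ?thesis by auto
qed

text \<open>By \<open>generic_edge\<close> every atom colours an edge from \<open>0\<close>, so the
  atoms below an element, and with them the element, can be recovered from its relation.\<close>

lemma R_inj: "inj_on R (carrier A)"
proof -
  have sub: "h a \<subseteq> h b" if ab: "a \<in> carrier A" "b \<in> carrier A" "R a = R b" for a b
  proof
    fix uv assume "uv \<in> h a"
    then obtain p where p: "p \<in> atoms A" "uv \<in> h p" "h p \<subseteq> h a" using atom_exists ab by blast
    obtain y where "g 0 y = p" using generic_edge[OF g p(1)] by blast
    then have "(0, y) \<in> R a" using p R_iff le_iff ab atom_carrier by blast
    then have "le A p b" using ab R_iff \<open>g 0 y = p\<close> by auto
    then show "uv \<in> h b" using p le_iff ab atom_carrier by blast
  qed
  have "a = b" if "a \<in> carrier A" "b \<in> carrier A" "R a = R b" for a b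
    using sub[OF that] sub[OF that(2,1) that(3)[symmetric]] h_eq that by blast
  then show ?thesis unfolding inj_on_def by blast
qed

lemma points_network_structure: "points (network_structure g) = UNIV"
  by (simp add: network_structure_def)

lemma network_structure_representation: "representation A (network_structure g)"
proof -
  define P where "P = (full_relalg UNIV UNIV)\<lparr>carrier := R ` carrier A\<rparr>"
  note hom = R_zero R_one R_ident R_compl R_join R_conv R_comp
  have closed_R:
    "{} \<in> R ` carrier A" "UNIV \<in> R ` carrier A" "Id \<in> R ` carrier A"
    "\<And>a. a \<in> carrier A \<Longrightarrow> UNIV - R a \<in> R ` carrier A"
    "\<And>a. a \<in> carrier A \<Longrightarrow> (R a)\<inverse> \<in> R ` carrier A"
    "\<And>a b. a \<in> carrier A \<Longrightarrow> b \<in> carrier A \<Longrightarrow> R a \<union> R b \<in> R ` carrier A"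
    "\<And>a b. a \<in> carrier A \<Longrightarrow> b \<in> carrier A \<Longrightarrow> R a O R b \<in> R ` carrier A"
    using hom closed by (metis imageI)+
  have Id: "Id_on UNIV = (Id :: nat rel)" by auto
  then have P_alg: "is_algebra P"
    using closed_R by (auto simp: is_algebra_def P_def full_relalg_def)
  have "subalgebra P (full_relalg UNIV UNIV)"
    using P_alg by (auto simp: subalgebra_def P_def full_relalg_def)
  moreover have "relalg_iso A P R"
    unfolding relalg_iso_def
    using alg P_alg R_inj hom Id
    by (auto simp: P_def full_relalg_def bij_betw_def)
  moreover have "equiv UNIV (UNIV :: nat rel)"
    by (auto simp: equiv_def refl_on_def sym_def trans_def)
  ultimately show ?thesis
    unfolding representation_def points_network_structure R_one by blast
qed

lemma network_structure_fully_universal: "fully_universal A (network_structure g)"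
  unfolding fully_universal_def
proof (intro allI impI)
  fix V :: "nat set" and n assume n: "atomic_closed_network A V n"
  have "\<exists>t. \<forall>x\<in>V. \<forall>y\<in>V. g (t x) (t y) = n x y"
  proof (rule generic_universal[OF g])
    show "finite V" using n unfolding atomic_closed_network_def by blast
    show K: "n x y \<in> atoms A" if "x \<in> V" "y \<in> V" for x y
      using n that unfolding atomic_closed_network_def by blast
    show "n x x = ident A" if "x \<in> V" for x
      using n that atom_le_ident K unfolding atomic_closed_network_def by blast
    show "n x y = conv A (n y x)" if "x \<in> V" "y \<in> V" for x y
      using n that unfolding atomic_closed_network_def by blast
    show "triangle (n x y) (n y z) (n x z)" if "x \<in> V" "y \<in> V" "z \<in> V" for x y z
      using n that K le_comp_iff[of "n x z" "n x y" "n y z"] atom_carrier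
      unfolding atomic_closed_network_def by blast
  qed
  then obtain t where t: "\<And>x y. x \<in> V \<Longrightarrow> y \<in> V \<Longrightarrow> g (t x) (t y) = n x y" by blast
  have "(t x, t y) \<in> R (n x y)" if "x \<in> V" "y \<in> V" for x y
    using t[OF that] R_atom g_atom by metis
  then show "satisfiable (network_structure g) V n"
    unfolding satisfiable_def points_network_structure by blast
qed

text \<open>Atoms are relation symbols themselves, so an isomorphism of substructures preserves
  colours and its graph is a finite partial isomorphism. Conversely, a colour-preserving bijection
  preserves every \<open>R a\<close>.\<close>

lemma network_structure_homogeneous: "homogeneous (carrier A) (network_structure g)"
  unfolding homogeneous_def
proof (intro allI impI, elim conjE)
  fix X Y f
  assume X: "finite X"
    and f: "struct_iso (carrier A) (substructure (network_structure g) X)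
      (substructure (network_structure g) Y) f"
  have "g (f x) (f y) = g x y" if xy: "x \<in> X" "y \<in> X" for x y
  proof -
    have "(x, y) \<in> R (g x y)" using R_atom g_atom by blast
    then have "(f x, f y) \<in> R (g x y)"
      using f xy g_atom atom_carrier unfolding struct_iso_def substructure_def by fastforce
    then show ?thesis using R_atom g_atom by blast
  qed
  then have "partial_iso g ((\<lambda>x. (x, f x)) ` X)" by (auto simp: partial_iso_def)
  then obtain k where k: "bij k" "\<And>x y. g (k x) (k y) = g x y" "\<And>x. x \<in> X \<Longrightarrow> k x = f x"
    using partial_iso_extends_automorphism[OF g, of "(\<lambda>x. (x, f x)) ` X"] X by auto
  have "struct_iso (carrier A) (network_structure g) (network_structure g) k"
    using k by (simp add: struct_iso_def points_network_structure R_iff)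
  then show "\<exists>k. struct_iso (carrier A) (network_structure g) (network_structure g) k \<and>
      (\<forall>x\<in>X. k x = f x)"
    using k(3) by blast
qed

lemma network_structure_normal: "normal_representation A (network_structure g)"
  unfolding normal_representation_def square_def
  using network_structure_representation network_structure_fully_universal
    network_structure_homogeneous
  by (simp add: points_network_structure R_one)

end

end

theorem proposition3p5:
  fixes A :: "'a relalg"
  assumes "finite (carrier A)"
    and "representable TYPE('b) A"
    and "integral A"
    and "\<exists>s. flexible A s"
  shows "\<exists>\<BB> :: ('a, nat) relstruct. normal_representation A \<BB>"
proof -
  obtain P :: "'b rel relalg" and h D E where P: "equiv D E" "subalgebra P (full_relalg D E)"
    and iso: "relalg_iso A P h"
    using assms(2) unfolding representable_def proper_relalg_def by blast
  obtain s where s: "flexible A s" using assms(4) by blast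
  have sub: "carrier P \<subseteq> Pow E" and P_eq: "P = (full_relalg D E)\<lparr>carrier := carrier P\<rparr>"
    using P(2) unfolding subalgebra_def by (auto simp: full_relalg_def)
  have ops: "join P = (\<union>)" "compl P = (\<lambda>a. E - a)" "zero P = {}" "one P = E"
    "ident P = Id_on D" "conv P = converse" "comp P = (O)"
    by (subst P_eq, simp add: full_relalg_def)+
  interpret flexible_integral_relalg A D E h s
  proof
    have "bij_betw h (carrier A) (carrier P)" using iso by (simp add: relalg_iso_def)
    then show "inj_on h (carrier A)" "\<And>a. a \<in> carrier A \<Longrightarrow> h a \<subseteq> E"
      using sub by (auto simp: bij_betw_def)
  qed (use assms(1,3) P(1) iso s in \<open>simp_all add: relalg_iso_def ops\<close>)
  show ?thesis using generic_exists network_structure_normal by blast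
qed

end
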